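(* Let $F$ be a field, $n\ge 1$, $m\ge 0$ an integer, and $A\in M_n(F)$. Then $A$ can be written as $A=KW$ with $K\in M_n(F)$ an almost lower triangular matrix with $m$ extra diagonals and $W\in M_n(F)$ an almost upper triangular matrix with $m$ extra diagonals if and only if for every $k=1,\ldots,n$ $$\operatorname{rank}A[\{1,\ldots,k\}]+k+m\ \ge\ \operatorname{rank}A[\{1,\ldots,k\},\{1,\ldots,n\}]+\operatorname{rank}A[\{1,\ldots,n\},\{1,\ldots,k\}].$$
   Context: $M_n(F)$ is the set of $n\times n$ matrices over $F$. For index sets $\alpha,\beta$, $A[\alpha,\beta]$ is the submatrix of $A$ with rows indexed by $\alpha$ and columns indexed by $\beta$, and $A[\alpha]=A[\alpha,\alpha]$. An $n\times n$ matrix $K=(k_{ij})$ is almost lower triangular with $m$ extra diagonals if $k_{ij}=0$ whenever $j>i+m$. An $n\times n$ matrix $W=(w_{ij})$ is almost upper triangular with $m$ extra diagonals if $w_{ij}=0$ whenever $i>j+m$. *)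

theory Defs
  imports "Jordan_Normal_Form.DL_Rank" "Jordan_Normal_Form.DL_Submatrix"
begin

text \<open>Matrix indices start at \<open>0\<close>, so the index set \<open>{1,...,k}\<close> is \<open>{0..<k}\<close> here. The two band
  conditions below only compare differences of indices and are unaffected by the shift.\<close>

definition almost_lower_triangular :: "nat \<Rightarrow> 'a::zero mat \<Rightarrow> bool" where
  "almost_lower_triangular m K \<longleftrightarrow>
     (\<forall>i < dim_row K. \<forall>j < dim_col K. j > i + m \<longrightarrow> K $$ (i, j) = 0)"

definition almost_upper_triangular :: "nat \<Rightarrow> 'a::zero mat \<Rightarrow> bool" where
  "almost_upper_triangular m W \<longleftrightarrow>
     (\<forall>i < dim_row W. \<forall>j < dim_col W. i > j + m \<longrightarrow> W $$ (i, j) = 0)"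

text \<open>\<^const>\<open>vec_space.rank\<close> (dimension of the column span) takes the dimension of the column
  vectors, i.e. the number of rows, as a parameter.\<close>

definition mat_rank :: "'a::field mat \<Rightarrow> nat" where
  "mat_rank A = vec_space.rank (dim_row A) A"

end

theory Submission
  imports Defs
begin

text \<open>Elimination without row exchanges writes any matrix as \<open>A = L \<Pi> U\<close> with \<open>L\<close> invertible lower
  triangular, \<open>U\<close> invertible upper triangular and \<open>\<Pi>\<close> the 0-1 matrix of a partial bijection \<open>P\<close>.
  Multiplying by \<open>L\<close> and \<open>U\<close> preserves both the ranks of the leading blocks and the band shapes of the
  factors, so only \<open>\<Pi>\<close> has to be factored; there the rank condition says that at most \<open>k + m\<close> pairs
  \<open>(i, j) \<in> P\<close> have \<open>min i j < k\<close>. Sorting the pairs by \<open>min i j\<close> gives each its own inner index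
  \<open>t \<le> min i j + m\<close>, that is, \<open>\<Pi> = K W\<close> with an entry \<open>1\<close> of \<open>K\<close> at \<open>(i, t)\<close> and of \<open>W\<close> at \<open>(t, j)\<close>.
  Conversely, the leading blocks of \<open>K W\<close> factor through dimension \<open>k + m\<close>, and Sylvester's rank
  inequality gives the condition.\<close>

section \<open>Leading submatrices\<close>

lemma index_mult_mat_sum:
  fixes A B :: "'a::semiring_0 mat"
  assumes "A \<in> carrier_mat p r" "B \<in> carrier_mat r q" "i < p" "j < q"
  shows "(A * B) $$ (i, j) = (\<Sum>l\<in>{0..<r}. A $$ (i, l) * B $$ (l, j))"
  using assms by (simp add: scalar_prod_def)

lemma pick_atLeast0LessThan: "i < a \<Longrightarrow> pick {0..<a} i = i"
proof -
  assume i: "i < a"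
  then have "{x \<in> {0..<a}. x < i} = {0..<i}" by auto
  then show ?thesis using pick_card_in_set[of i "{0..<a}"] i by simp
qed

lemma submatrix_leading:
  assumes "A \<in> carrier_mat p q" "a \<le> p" "b \<le> q"
  shows "submatrix A {0..<a} {0..<b} = mat a b (\<lambda>(i, j). A $$ (i, j))"
proof -
  have "{i. i < p \<and> i \<in> {0..<a}} = {0..<a}" "{i. i < q \<and> i \<in> {0..<b}} = {0..<b}"
    using assms by auto
  then show ?thesis using assms unfolding submatrix_def
    by (intro eq_matI) (auto simp: pick_atLeast0LessThan)
qed

text \<open>The products with inner index at least \<open>s\<close> vanish, so the sum over
  \<open>l\<close> stops at \<open>s\<close>. Triangular factors give this with \<open>s\<close> the
  size of the block, factors with \<open>m\<close> extra diagonals with \<open>s\<close> up to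
  \<open>m\<close> larger.\<close>

lemma submatrix_leading_mult:
  fixes K X :: "'a::semiring_0 mat"
  assumes K: "K \<in> carrier_mat p r" and X: "X \<in> carrier_mat r q"
    and le: "a \<le> p" "b \<le> q" "s \<le> r"
    and zero: "\<And>i j l. i < a \<Longrightarrow> j < b \<Longrightarrow> s \<le> l \<Longrightarrow> l < r \<Longrightarrow> K $$ (i, l) * X $$ (l, j) = 0"
  shows "submatrix (K * X) {0..<a} {0..<b}
    = submatrix K {0..<a} {0..<s} * submatrix X {0..<s} {0..<b}"
proof (rule eq_matI)
  have KX: "K * X \<in> carrier_mat p q" using K X by simp
  note sub = submatrix_leading[OF KX le(1,2)] submatrix_leading[OF K le(1,3)]
    submatrix_leading[OF X le(3,2)]
  fix i j assume "i < dim_row (submatrix K {0..<a} {0..<s} * submatrix X {0..<s} {0..<b})"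
    "j < dim_col (submatrix K {0..<a} {0..<s} * submatrix X {0..<s} {0..<b})"
  then have ij: "i < a" "j < b" by (auto simp: sub)
  have "(\<Sum>l\<in>{0..<r}. K $$ (i, l) * X $$ (l, j)) = (\<Sum>l\<in>{0..<s}. K $$ (i, l) * X $$ (l, j))"
    using le ij zero by (intro sum.mono_neutral_right) simp_all
  then show "submatrix (K * X) {0..<a} {0..<b} $$ (i, j)
    = (submatrix K {0..<a} {0..<s} * submatrix X {0..<s} {0..<b}) $$ (i, j)"
    using ij le index_mult_mat_sum[OF K X, of i j]
      index_mult_mat_sum[of "submatrix K {0..<a} {0..<s}" a s "submatrix X {0..<s} {0..<b}" b i j]
    by (simp add: sub)
qed (use K X le in \<open>auto simp: submatrix_leading[of _ p q] submatrix_leading[of _ p r] submatrix_leading[of _ r q]\<close>)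

section \<open>Zero-one matrices of relations\<close>

text \<open>Indexing 0-1 matrices by relations turns matrix products into compositions
  \<open>O\<close> and transposes into converses.\<close>

definition relation_mat :: "nat \<Rightarrow> nat \<Rightarrow> (nat \<times> nat) set \<Rightarrow> 'a::zero_neq_one mat" where
  "relation_mat p q P = mat p q (\<lambda>x. of_bool (x \<in> P))"

lemma relation_mat_carrier [simp]: "relation_mat p q P \<in> carrier_mat p q"
  by (simp add: relation_mat_def)

lemma dim_row_relation_mat [simp]: "dim_row (relation_mat p q P) = p"
  by (simp add: relation_mat_def)

lemma dim_col_relation_mat [simp]: "dim_col (relation_mat p q P) = q"
  by (simp add: relation_mat_def)

lemma relation_mat_index [simp]:
  "i < p \<Longrightarrow> j < q \<Longrightarrow> relation_mat p q P $$ (i, j) = of_bool ((i, j) \<in> P)"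
  by (simp add: relation_mat_def)

lemma relation_mat_Id: "relation_mat n n (Id_on {..<n}) = 1\<^sub>m n"
  by (rule eq_matI) auto

text \<open>Since \<open>P\<close> is single-valued, row \<open>i\<close> of the left factor has at
  most one \<open>1\<close>, so the sum over the inner index is 0 or 1 instead of a count of paths.
  The bound on \<open>Range P\<close> keeps that \<open>1\<close> inside the matrix.\<close>

lemma relation_mat_mult:
  assumes P: "single_valued P" "Range P \<subseteq> {..<r}"
  shows "relation_mat p r P * relation_mat r q Q = (relation_mat p q (P O Q) :: 'a::semiring_1 mat)"
proof (rule eq_matI)
  fix i j assume "i < dim_row (relation_mat p q (P O Q) :: 'a mat)" "j < dim_col (relation_mat p q (P O Q) :: 'a mat)"
  then have ij: "i < p" "j < q" by auto
  have "(relation_mat p r P * relation_mat r q Q :: 'a mat) $$ (i, j)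
    = (\<Sum>l\<in>{0..<r}. of_bool ((i, l) \<in> P) * of_bool ((l, j) \<in> Q))"
    using ij by (simp add: scalar_prod_def)
  also have "\<dots> = of_bool ((i, j) \<in> P O Q)"
  proof (cases "\<exists>l. (i, l) \<in> P")
    case True
    then obtain l where l: "(i, l) \<in> P" by blast
    then have u: "(i, l') \<in> P \<longleftrightarrow> l' = l" for l' using P(1) by (auto dest: single_valuedD)
    then have "(i, j) \<in> P O Q \<longleftrightarrow> (l, j) \<in> Q" by auto
    moreover have "l < r" using l P(2) by auto
    ultimately show ?thesis by (simp add: u if_distrib[of "\<lambda>x. x * _"] of_bool_def sum.delta cong: if_cong)
  qed auto
  finally show "(relation_mat p r P * relation_mat r q Q :: 'a mat) $$ (i, j)
    = relation_mat p q (P O Q) $$ (i, j)" using ij by simp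
qed auto

definition partial_bij :: "(nat \<times> nat) set \<Rightarrow> bool" where
  "partial_bij P \<longleftrightarrow> single_valued P \<and> single_valued (P\<inverse>)"

lemma partial_bij_subset: "partial_bij P \<Longrightarrow> Q \<subseteq> P \<Longrightarrow> partial_bij Q"
  unfolding partial_bij_def using single_valued_subset by (metis converse_mono)

section \<open>Triangular matrices and elimination\<close>

text \<open>A step from \<open>i\<close> to \<open>j\<close> of more than \<open>m + m'\<close>
  through any \<open>l\<close> exceeds \<open>m\<close> before \<open>l\<close> or \<open>m'\<close>
  after it. With one width equal to 0, a triangular factor leaves the band of the other factor
  unchanged.\<close>

lemma almost_lower_triangular_mult:
  fixes K L :: "'a::semiring_0 mat"
  assumes K: "K \<in> carrier_mat p r" "almost_lower_triangular m K"
    and L: "L \<in> carrier_mat r q" "almost_lower_triangular m' L"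
  shows "almost_lower_triangular (m + m') (K * L)"
  unfolding almost_lower_triangular_def
proof (intro allI impI)
  fix i j assume ij: "i < dim_row (K * L)" "j < dim_col (K * L)" and gt: "i + (m + m') < j"
  have "K $$ (i, l) * L $$ (l, j) = 0" if "l < r" for l
  proof (cases "l > i + m")
    case True
    then show ?thesis using K ij that by (simp add: almost_lower_triangular_def)
  next
    case False
    then have "j > l + m'" using gt by simp
    then show ?thesis using L ij that by (simp add: almost_lower_triangular_def)
  qed
  then show "(K * L) $$ (i, j) = 0" using K L ij by (simp add: scalar_prod_def)
qed

lemma almost_upper_triangular_transpose:
  "almost_upper_triangular m W \<longleftrightarrow> almost_lower_triangular m (transpose_mat W)"
  unfolding almost_upper_triangular_def almost_lower_triangular_def by fastforce

lemma almost_upper_triangular_mult: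
  fixes V W :: "'a::comm_semiring_0 mat"
  assumes V: "V \<in> carrier_mat p r" "almost_upper_triangular m V"
    and W: "W \<in> carrier_mat r q" "almost_upper_triangular m' W"
  shows "almost_upper_triangular (m + m') (V * W)"
  using almost_lower_triangular_mult[of "transpose_mat W" q r m' "transpose_mat V" p m] V W
  by (simp add: almost_upper_triangular_transpose transpose_mult add.commute)

text \<open>Over a field, a triangular matrix is invertible exactly when its diagonal has no zero;
  this entrywise form can be read off directly and passes to leading blocks.\<close>

definition invertible_lower :: "nat \<Rightarrow> 'a::semiring_1 mat \<Rightarrow> bool" where
  "invertible_lower n L \<longleftrightarrow>
     L \<in> carrier_mat n n \<and> almost_lower_triangular 0 L \<and> (\<forall>i<n. L $$ (i, i) \<noteq> 0)"

definition invertible_upper :: "nat \<Rightarrow> 'a::semiring_1 mat \<Rightarrow> bool" where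
  "invertible_upper n U \<longleftrightarrow>
     U \<in> carrier_mat n n \<and> almost_upper_triangular 0 U \<and> (\<forall>i<n. U $$ (i, i) \<noteq> 0)"

lemma invertible_lower_carrier: "invertible_lower n L \<Longrightarrow> L \<in> carrier_mat n n"
  by (simp add: invertible_lower_def)

lemma invertible_upper_carrier: "invertible_upper n U \<Longrightarrow> U \<in> carrier_mat n n"
  by (simp add: invertible_upper_def)

lemma invertible_lower_zero: "invertible_lower n L \<Longrightarrow> i < j \<Longrightarrow> j < n \<Longrightarrow> L $$ (i, j) = 0"
  by (auto simp: invertible_lower_def almost_lower_triangular_def)

lemma invertible_upper_zero: "invertible_upper n U \<Longrightarrow> j < i \<Longrightarrow> i < n \<Longrightarrow> U $$ (i, j) = 0"
  by (auto simp: invertible_upper_def almost_upper_triangular_def)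

lemma invertible_upper_transpose:
  "invertible_upper n U \<longleftrightarrow> invertible_lower n (transpose_mat U)"
  by (auto simp: invertible_upper_def invertible_lower_def almost_upper_triangular_transpose)

lemma det_invertible_lower:
  fixes L :: "'a::idom mat"
  assumes L: "invertible_lower n L"
  shows "det L \<noteq> 0"
proof -
  have "det L = prod_list (diag_mat L)"
    using invertible_lower_zero[OF L] invertible_lower_carrier[OF L] by (rule det_lower_triangular)
  then show ?thesis using L by (auto simp: prod_list_zero_iff diag_mat_def invertible_lower_def)
qed

lemma det_invertible_upper:
  fixes U :: "'a::idom mat"
  assumes U: "invertible_upper n U"
  shows "det U \<noteq> 0"
  using det_invertible_lower[OF U[unfolded invertible_upper_transpose]]
    det_transpose[OF invertible_upper_carrier[OF U]] by simp

lemma invertible_lower_one: "invertible_lower n (1\<^sub>m n)"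
  by (auto simp: invertible_lower_def almost_lower_triangular_def)

lemma invertible_upper_one: "invertible_upper n (1\<^sub>m n)"
  by (auto simp: invertible_upper_def almost_upper_triangular_def)

text \<open>In a diagonal entry of the product, the terms with \<open>l < i\<close> vanish through
  \<open>L\<close> and those with \<open>l > i\<close> through \<open>K\<close>, which leaves the
  product of the two diagonal entries.\<close>

lemma invertible_lower_mult:
  fixes K L :: "'a::idom mat"
  assumes K: "invertible_lower n K" and L: "invertible_lower n L"
  shows "invertible_lower n (K * L)"
proof -
  note c = invertible_lower_carrier[OF K] invertible_lower_carrier[OF L]
  have "(K * L) $$ (i, i) = K $$ (i, i) * L $$ (i, i)" if i: "i < n" for i
  proof -
    have "K $$ (i, l) * L $$ (l, i) = 0" if "l \<in> {0..<n} - {i}" for l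
      using that i invertible_lower_zero[OF K, of i l] invertible_lower_zero[OF L, of l i]
      by (cases "l < i") simp_all
    then have "(\<Sum>l\<in>{0..<n}. K $$ (i, l) * L $$ (l, i)) = (\<Sum>l\<in>{i}. K $$ (i, l) * L $$ (l, i))"
      using i by (intro sum.mono_neutral_right) simp_all
    then show ?thesis using index_mult_mat_sum[OF c i i] by simp
  qed
  then show ?thesis
    using K L c almost_lower_triangular_mult[of K n n 0 L n 0]
    by (simp add: invertible_lower_def)
qed

lemma invertible_upper_mult:
  fixes V W :: "'a::idom mat"
  assumes V: "invertible_upper n V" and W: "invertible_upper n W"
  shows "invertible_upper n (V * W)"
  using invertible_lower_mult[of n "transpose_mat W" "transpose_mat V"] V W
    transpose_mult[OF invertible_upper_carrier[OF V] invertible_upper_carrier[OF W]]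
  by (simp add: invertible_upper_transpose)

text \<open>Invariant of the elimination after \<open>k\<close> rows, with \<open>P\<close> the set
  of pivot positions: the first \<open>k\<close> rows and all pivot columns are already final, the
  other entries are arbitrary.\<close>

definition eliminated :: "nat \<Rightarrow> (nat \<times> nat) set \<Rightarrow> 'a::zero_neq_one mat \<Rightarrow> bool" where
  "eliminated k P M \<longleftrightarrow> partial_bij P \<and> P \<subseteq> {..<k} \<times> {..<dim_col M} \<and>
     (\<forall>i<dim_row M. \<forall>j<dim_col M. i < k \<or> j \<in> Range P \<longrightarrow> M $$ (i, j) = of_bool ((i, j) \<in> P))"

lemma elimination_step:
  fixes M :: "'a::field mat"
  assumes M: "M \<in> carrier_mat p q" and k: "k < p" and el: "eliminated k P M"
  obtains E F M' P' where "invertible_lower p E" "invertible_upper q F" "M' \<in> carrier_mat p q"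
    "M = E * M' * F" "eliminated (Suc k) P' M'"
proof (cases "\<forall>j<q. M $$ (k, j) = 0")
  case True
  have "eliminated (Suc k) P M"
    using el True M k unfolding eliminated_def by (auto simp: less_Suc_eq)
  moreover have "M = 1\<^sub>m p * M * 1\<^sub>m q" using M by simp
  ultimately show thesis using that invertible_lower_one invertible_upper_one M by blast
next
  case False
  \<comment> \<open>The leftmost nonzero entry of row \<open>k\<close> is the pivot: the zeros to
    its left make \<open>F\<close> upper triangular.\<close>
  define t where "t = (LEAST j. j < q \<and> M $$ (k, j) \<noteq> 0)"
  have t: "t < q" "M $$ (k, t) \<noteq> 0"
    using LeastI_ex[of "\<lambda>j. j < q \<and> M $$ (k, j) \<noteq> 0"] False by (auto simp: t_def)
  have before_t: "M $$ (k, j) = 0" if "j < t" for j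
    using not_less_Least[of j "\<lambda>j. j < q \<and> M $$ (k, j) \<noteq> 0"] that t unfolding t_def by auto
  have dim: "dim_row M = p" "dim_col M = q" using M by auto
  have bij: "partial_bij P" and sub: "P \<subseteq> {..<k} \<times> {..<q}"
    and ent: "\<And>i j. i < p \<Longrightarrow> j < q \<Longrightarrow> i < k \<or> j \<in> Range P \<Longrightarrow> M $$ (i, j) = of_bool ((i, j) \<in> P)"
    using el unfolding eliminated_def dim by blast+
  \<comment> \<open>Earlier pivot columns vanish in row \<open>k\<close>, so clearing with the new
    pivot does not disturb them.\<close>
  have row_k: "M $$ (k, j) = 0" if "j \<in> Range P" for j
  proof -
    have "j < q" "(k, j) \<notin> P" using that sub by auto
    then show ?thesis using ent[of k j] that k by simp
  qed
  then have tP: "t \<notin> Range P" using t by blast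
  \<comment> \<open>The pivot column vanishes above row \<open>k\<close>: this makes
    \<open>E\<close> lower triangular and leaves the finished rows unchanged.\<close>
  have col_t: "M $$ (i, t) = 0" if "i < k" for i
    using ent[of i t] that tP t k by auto
  \<comment> \<open>With \<open>v\<close> and \<open>w\<close> the pivot column and row and \<open>c\<close> the pivot, \<open>M' = M - v w / c + e\<^sub>k e\<^sub>t\<^sup>T\<close>;
    \<open>E\<close> and \<open>F\<close> are identity matrices with column \<open>k\<close> replaced by \<open>v\<close> and row \<open>t\<close> by \<open>w / c\<close>.\<close>
  define E where "E = mat p p (\<lambda>(i, l). if l = k then M $$ (i, t) else of_bool (i = l))"
  define F where "F = mat q q (\<lambda>(l, j). if l = t then M $$ (k, j) / M $$ (k, t) else of_bool (l = j))"
  define M' where "M' = mat p q (\<lambda>(i, j).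
    M $$ (i, j) - M $$ (i, t) * M $$ (k, j) / M $$ (k, t) + of_bool (i = k \<and> j = t))"
  define P' where "P' = insert (k, t) P"
  have E: "invertible_lower p E"
    using t col_t by (auto simp: invertible_lower_def almost_lower_triangular_def E_def)
  have F: "invertible_upper q F"
    using t before_t by (auto simp: invertible_upper_def almost_upper_triangular_def F_def)
  \<comment> \<open>Row \<open>k\<close> of \<open>M'\<close> is the unit row with its
    \<open>1\<close> at \<open>t\<close>, so column \<open>k\<close> of \<open>E\<close> puts the
    pivot column back into column \<open>t\<close>. Row \<open>t\<close> of \<open>F\<close> then
    spreads it over the other columns and restores the subtracted term.\<close>
  have EM': "(E * M') $$ (i, j) = M $$ (i, j) - M $$ (i, t) * M $$ (k, j) / M $$ (k, t)
      + M $$ (i, t) * of_bool (j = t)" if ij: "i < p" "j < q" for i j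
  proof -
    have "(E * M') $$ (i, j) = (\<Sum>l\<in>{0..<p}. E $$ (i, l) * M' $$ (l, j))"
      using ij by (intro index_mult_mat_sum[of _ p p _ q]) (auto simp: E_def M'_def)
    also have "\<dots> = E $$ (i, k) * M' $$ (k, j) + (\<Sum>l\<in>{0..<p} - {k}. E $$ (i, l) * M' $$ (l, j))"
      using k by (intro sum.remove) auto
    also have "(\<Sum>l\<in>{0..<p} - {k}. E $$ (i, l) * M' $$ (l, j))
        = (\<Sum>l\<in>{0..<p} - {k}. if l = i then M' $$ (l, j) else 0)"
      using ij by (intro sum.cong) (auto simp: E_def)
    also have "\<dots> = (if i = k then 0 else M' $$ (i, j))"
      using ij by (simp add: sum.delta)
    finally show ?thesis
      using ij k t by (auto simp: E_def M'_def)
  qed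
  have "M = E * M' * F"
  proof (rule eq_matI)
    fix i j assume "i < dim_row (E * M' * F)" "j < dim_col (E * M' * F)"
    then have ij: "i < p" "j < q" by (auto simp: E_def F_def)
    have "(E * M' * F) $$ (i, j) = (\<Sum>l\<in>{0..<q}. (E * M') $$ (i, l) * F $$ (l, j))"
      using ij by (intro index_mult_mat_sum[of _ p q _ q]) (auto simp: E_def F_def M'_def)
    also have "\<dots> = (E * M') $$ (i, t) * F $$ (t, j) + (\<Sum>l\<in>{0..<q} - {t}. (E * M') $$ (i, l) * F $$ (l, j))"
      using t by (intro sum.remove) auto
    also have "(\<Sum>l\<in>{0..<q} - {t}. (E * M') $$ (i, l) * F $$ (l, j))
        = (\<Sum>l\<in>{0..<q} - {t}. if l = j then (E * M') $$ (i, l) else 0)"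
      using ij by (intro sum.cong) (auto simp: F_def)
    also have "\<dots> = (if j = t then 0 else (E * M') $$ (i, j))"
      using ij by (simp add: sum.delta)
    finally show "M $$ (i, j) = (E * M' * F) $$ (i, j)"
      using ij k t by (auto simp: EM' F_def)
  qed (use M in \<open>auto simp: E_def F_def\<close>)
  moreover have "eliminated (Suc k) P' M'"
    unfolding eliminated_def
  proof (intro conjI allI impI)
    show "partial_bij P'"
      using bij sub tP unfolding partial_bij_def P'_def single_valued_def by blast
    show "P' \<subseteq> {..<Suc k} \<times> {..<dim_col M'}"
      using sub t by (auto simp: P'_def M'_def less_Suc_eq)
    fix i j assume ij: "i < dim_row M'" "j < dim_col M'" and h: "i < Suc k \<or> j \<in> Range P'"
    then have ij': "i < p" "j < q" by (auto simp: M'_def)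
    have kP: "(k, j') \<notin> P" for j' using sub by auto
    have "i < k \<or> i = k \<or> j = t \<and> k < i \<or> j \<in> Range P \<and> k < i"
      using h less_linear[of i k] by (auto simp: P'_def less_Suc_eq)
    \<comment> \<open>Finished rows stay unchanged, row \<open>k\<close> becomes a unit row, column
      \<open>t\<close> is cleared below the pivot, and earlier pivot columns stay unchanged.\<close>
    then consider "i < k" | "i = k" | "j = t" "k < i" | "j \<in> Range P" "k < i" by blast
    then show "M' $$ (i, j) = of_bool ((i, j) \<in> P')"
    proof cases
      case 1
      then show ?thesis using ij' ent[of i j] col_t by (auto simp: M'_def P'_def)
    next
      case 2
      then show ?thesis using ij' t kP by (auto simp: M'_def P'_def)
    next
      case 3
      then show ?thesis using ij' t tP by (auto simp: M'_def P'_def)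
    next
      case 4
      then show ?thesis using ij' ent[of i j] row_k tP by (auto simp: M'_def P'_def)
    qed
  qed
  moreover have "M' \<in> carrier_mat p q" by (simp add: M'_def)
  ultimately show thesis using that E F by blast
qed

text \<open>The factors of each step stand next to the remaining matrix, so \<open>E\<close> is
  absorbed by \<open>L\<close> from the right and \<open>F\<close> by \<open>U\<close> from the
  left.\<close>

lemma elimination:
  fixes A :: "'a::field mat"
  assumes A: "A \<in> carrier_mat p q" and "k \<le> p"
  shows "\<exists>L U M P. invertible_lower p L \<and> invertible_upper q U \<and> M \<in> carrier_mat p q \<and>
    A = L * M * U \<and> eliminated k P M"
  using \<open>k \<le> p\<close>
proof (induction k)
  case 0
  have "eliminated 0 {} A" by (simp add: eliminated_def partial_bij_def)
  moreover have "A = 1\<^sub>m p * A * 1\<^sub>m q" using A by simp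
  ultimately show ?case using invertible_lower_one invertible_upper_one A by blast
next
  case (Suc k)
  then obtain L U M P where L: "invertible_lower p L" and U: "invertible_upper q U"
    and M: "M \<in> carrier_mat p q" and A: "A = L * M * U" and el: "eliminated k P M" by auto
  obtain E F M' P' where E: "invertible_lower p E" and F: "invertible_upper q F"
    and M': "M' \<in> carrier_mat p q" and eq: "M = E * M' * F" and el': "eliminated (Suc k) P' M'"
    using elimination_step[OF M Suc_le_lessD[OF Suc.prems] el] .
  note c = invertible_lower_carrier[OF L] invertible_lower_carrier[OF E]
    invertible_upper_carrier[OF U] invertible_upper_carrier[OF F]
  have "A = (L * E) * M' * (F * U)"
    unfolding A eq using c M' by (simp add: assoc_mult_mat[of _ p p _ p _ q]
      assoc_mult_mat[of _ p p _ q _ q] assoc_mult_mat[of _ p q _ q _ q])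
  then show ?case
    using invertible_lower_mult[OF L E] invertible_upper_mult[OF F U] M' el' by blast
qed

text \<open>Once all \<open>p\<close> rows are processed, the invariant fixes every entry of the
  middle matrix.\<close>

lemma lower_relation_upper_factorization:
  fixes A :: "'a::field mat"
  assumes A: "A \<in> carrier_mat p q"
  obtains L P U where "invertible_lower p L" "invertible_upper q U" "partial_bij P"
    "P \<subseteq> {..<p} \<times> {..<q}" "A = L * relation_mat p q P * U"
proof -
  obtain L U M P where h: "invertible_lower p L" "invertible_upper q U" "M \<in> carrier_mat p q"
    "A = L * M * U" "eliminated p P M" using elimination[OF A order_refl] by blast
  have "M = relation_mat p q P"
    using h(3,5) by (intro eq_matI) (auto simp: eliminated_def)
  with h that show thesis by (auto simp: eliminated_def)
qed

section \<open>Banded factors of partial permutation matrices\<close>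

text \<open>\<open>t\<close> is the position in an enumeration sorted by \<open>f\<close>.\<close>

lemma bij_betw_rank_bound:
  fixes f :: "'b \<Rightarrow> nat"
  assumes "finite S"
  shows "\<exists>t. bij_betw t S {..<card S} \<and> (\<forall>x\<in>S. t x < card {y \<in> S. f y \<le> f x})"
  using assms
proof (induction S rule: finite_ranking_induct[where f = f])
  \<comment> \<open>The element \<open>x\<close> added last has the largest value of
    \<open>f\<close>. It takes the last position \<open>card S\<close>, and the set in its bound is
    all of \<open>insert x S\<close>.\<close>
  case (insert x S)
  show ?case
  proof (cases "x \<in> S")
    case False
    obtain t where t: "bij_betw t S {..<card S}" "\<And>y. y \<in> S \<Longrightarrow> t y < card {z \<in> S. f z \<le> f y}"
      using insert.IH by blast
    let ?t = "t(x := card S)"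
    have "bij_betw ?t S {..<card S}" using t(1) False by (subst bij_betw_cong[of S _ t]) auto
    then have "bij_betw ?t (insert x S) (insert (card S) {..<card S})"
      using notIn_Un_bij_betw[of x S ?t "{..<card S}"] False by simp
    then have "bij_betw ?t (insert x S) {..<card (insert x S)}"
      using False insert.hyps by (simp add: lessThan_Suc)
    moreover have "?t y < card {z \<in> insert x S. f z \<le> f y}" if y: "y \<in> insert x S" for y
    proof (cases "y = x")
      case True
      have "{z \<in> insert x S. f z \<le> f x} = insert x S" using insert.hyps by auto
      then show ?thesis using True False insert.hyps by simp
    next
      case False
      then have "t y < card {z \<in> S. f z \<le> f y}" using t(2) y by blast
      also have "\<dots> \<le> card {z \<in> insert x S. f z \<le> f y}"
        using insert.hyps by (intro card_mono) auto
      finally show ?thesis using False by simp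
    qed
    ultimately show ?thesis by blast
  qed (use insert.IH in \<open>simp add: insert_absorb\<close>)
qed (simp add: bij_betw_def)

text \<open>Sufficiency for 0-1 matrices: the hypothesis on \<open>card\<close> is the rank
  condition, the rank of a leading block being the number of pairs in it.\<close>

lemma relation_mat_factorization:
  assumes P: "partial_bij P" "P \<subseteq> {..<n} \<times> {..<n}"
    and card: "\<And>k. 1 \<le> k \<Longrightarrow> k \<le> n \<Longrightarrow>
      card (P \<inter> {..<k} \<times> {..<n}) + card (P \<inter> {..<n} \<times> {..<k}) \<le> card (P \<inter> {..<k} \<times> {..<k}) + k + m"
  obtains K W :: "'a::semiring_1 mat" where "K \<in> carrier_mat n n" "W \<in> carrier_mat n n"
    "almost_lower_triangular m K" "almost_upper_triangular m W" "relation_mat n n P = K * W"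
proof -
  have fin: "finite P" using P(2) finite_subset by blast
  obtain t where t: "bij_betw t P {..<card P}"
    "\<And>x. x \<in> P \<Longrightarrow> t x < card {y \<in> P. min (fst y) (snd y) \<le> min (fst x) (snd x)}"
    using bij_betw_rank_bound[OF fin, of "\<lambda>x. min (fst x) (snd x)"] by blast
  have le: "t x \<le> min (fst x) (snd x) + m" if x: "x \<in> P" for x
  proof -
    \<comment> \<open>The successor makes \<open>k\<close> positive and turns the non-strict
      comparison of minima into membership in the first \<open>k\<close> rows or columns.\<close>
    define k where "k = Suc (min (fst x) (snd x))"
    have k: "1 \<le> k" "k \<le> n" using x P(2) by (auto simp: k_def min_def)
    have "min (fst y) (snd y) \<le> min (fst x) (snd x) \<longleftrightarrow> fst y < k \<or> snd y < k" for y :: "nat \<times> nat"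
      unfolding k_def less_Suc_eq_le by (rule min_le_iff_disj)
    then have eq: "{y \<in> P. min (fst y) (snd y) \<le> min (fst x) (snd x)}
      = P \<inter> {..<k} \<times> {..<n} \<union> P \<inter> {..<n} \<times> {..<k}"
      using P(2) by auto
    have int: "(P \<inter> {..<k} \<times> {..<n}) \<inter> (P \<inter> {..<n} \<times> {..<k}) = P \<inter> {..<k} \<times> {..<k}"
      using k by auto
    \<comment> \<open>Inclusion-exclusion turns the hypothesis into this bound; the strict
      inequality for \<open>t x\<close> then absorbs the successor in \<open>k\<close>.\<close>
    have "card (P \<inter> {..<k} \<times> {..<n} \<union> P \<inter> {..<n} \<times> {..<k}) \<le> k + m"
      using card_Un_Int[of "P \<inter> {..<k} \<times> {..<n}" "P \<inter> {..<n} \<times> {..<k}"] card[OF k] fin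
      by (simp add: int)
    then show ?thesis using t(2)[OF x] unfolding eq by (simp add: k_def)
  qed
  \<comment> \<open>The band bound alone may exceed \<open>n\<close>; the inner index fits because
    distinct pairs lie in distinct rows, so there are at most \<open>n\<close> of them.\<close>
  have lt: "t x < n" if x: "x \<in> P" for x
  proof -
    have "inj_on fst P" using P(1) unfolding partial_bij_def inj_on_def single_valued_def by force
    then have "card P = card (fst ` P)" by (simp add: card_image)
    also have "\<dots> \<le> card {..<n}" using P(2) by (intro card_mono) auto
    finally have "card P \<le> n" by simp
    moreover have "t x < card P" using bij_betwE[OF t(1)] x by auto
    ultimately show ?thesis by simp
  qed
  \<comment> \<open>Each pair \<open>(i, j)\<close> is routed through its own index
    \<open>t\<close>: since \<open>t\<close> is at most \<open>min i j + m\<close>,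
    \<open>(i, t)\<close> lies in the band of \<open>K\<close> and \<open>(t, j)\<close> in that of
    \<open>W\<close>.\<close>
  define R where "R = (\<lambda>x. (fst x, t x)) ` P"
  define S where "S = (\<lambda>x. (t x, snd x)) ` P"
  have inj: "x = y" if "x \<in> P" "y \<in> P" "t x = t y" for x y
    using t(1) that by (auto simp: bij_betw_def inj_on_def)
  have leR: "j \<le> i + m" if "(i, j) \<in> R" for i j
  proof -
    from that obtain x where "x \<in> P" "i = fst x" "j = t x" by (auto simp: R_def)
    then show ?thesis using le[of x] by simp
  qed
  have leS: "i \<le> j + m" if "(i, j) \<in> S" for i j
  proof -
    from that obtain x where "x \<in> P" "i = t x" "j = snd x" by (auto simp: S_def)
    then show ?thesis using le[of x] by simp
  qed
  \<comment> \<open>Injectivity of \<open>t\<close> on \<open>P\<close> excludes compositions that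
    mix the row of one pair with the column of another.\<close>
  have "R O S = P"
  proof (intro equalityI subsetI)
    fix z assume "z \<in> R O S"
    then obtain x y where "x \<in> P" "y \<in> P" "t x = t y" "z = (fst x, snd y)"
      by (auto simp: R_def S_def)
    moreover from this have "x = y" using inj by blast
    ultimately show "z \<in> P" by simp
  next
    fix z assume "z \<in> P"
    then have "(fst z, t z) \<in> R" "(t z, snd z) \<in> S" by (auto simp: R_def S_def)
    then show "z \<in> R O S" by (metis relcomp.intros prod.collapse)
  qed
  moreover have "single_valued R"
  proof (rule single_valuedI)
    fix i u v assume "(i, u) \<in> R" "(i, v) \<in> R"
    then obtain x y where x: "x \<in> P" "y \<in> P" "fst x = i" "fst y = i" "u = t x" "v = t y"
      by (auto simp: R_def)
    then have "snd x = snd y"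
      using P(1) by (metis partial_bij_def prod.collapse single_valuedD)
    then have "x = y" using x by (simp add: prod_eq_iff)
    then show "u = v" using x by simp
  qed
  moreover have "Range R \<subseteq> {..<n}" using lt by (auto simp: R_def)
  ultimately have "relation_mat n n P = (relation_mat n n R * relation_mat n n S :: 'a mat)"
    by (simp add: relation_mat_mult)
  moreover have "almost_lower_triangular m (relation_mat n n R :: 'a mat)"
    by (auto simp: almost_lower_triangular_def dest: leR)
  moreover have "almost_upper_triangular m (relation_mat n n S :: 'a mat)"
    by (auto simp: almost_upper_triangular_def dest: leS)
  ultimately show thesis using that relation_mat_carrier by blast
qed

section \<open>Rank\<close>

lemma mat_rank_le_dim_col: "mat_rank A \<le> dim_col A"
  unfolding mat_rank_def by (rule vec_space.rank_le_nc[of _ "dim_row A"]) simp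

lemma mat_rank_add_le:
  fixes A B :: "'a::field mat"
  assumes "A \<in> carrier_mat p q" "B \<in> carrier_mat p q"
  shows "mat_rank (A + B) \<le> mat_rank A + mat_rank B"
  using vec_space.rank_subadditive[OF assms] assms by (simp add: mat_rank_def)

lemma mat_rank_one: "mat_rank (1\<^sub>m n :: 'a::field mat) = n"
  using vec_space.det_rank_iff[of "1\<^sub>m n :: 'a mat" n] by (simp add: mat_rank_def)

text \<open>Every column of \<open>X * Y\<close> is \<open>X\<close> applied to a column of
  \<open>Y\<close>, so it lies in the column span of \<open>X\<close>.\<close>

lemma (in vec_space) rank_mult_le_left:
  assumes X: "X \<in> carrier_mat n r" and Y: "Y \<in> carrier_mat r q"
  shows "rank (X * Y) \<le> rank X"
proof -
  have cX: "set (cols X) \<subseteq> carrier_vec n" using cols_dim X by blast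
  have XY: "X * Y \<in> carrier_mat n q" using X Y by simp
  have "set (cols (X * Y)) \<subseteq> span (set (cols X))"
  proof
    fix v assume "v \<in> set (cols (X * Y))"
    then obtain j where j: "j < q" "v = col (X * Y) j"
      using XY unfolding cols_def by auto
    have "v = X *\<^sub>v col Y j" unfolding j(2) by (rule col_mult2[OF X Y j(1)])
    moreover have "X *\<^sub>v col Y j \<in> span (set (cols X))"
      using Y X j unfolding col_space_def[symmetric] col_space_eq[OF X] by auto
    ultimately show "v \<in> span (set (cols X))" by simp
  qed
  then have sub: "span (set (cols (X * Y))) \<subseteq> span (set (cols X))"
    using cX by (simp add: span_is_submodule span_is_subset)
  have s1: "VectorSpace.subspace class_ring (span (set (cols X))) V"
    and s2: "VectorSpace.subspace class_ring (span (set (cols (X * Y)))) V"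
    using cX cols_dim[of "X * Y"] X XY by (auto intro!: span_is_subspace)
  have "vectorspace.dim class_ring (span_vs (set (cols (X * Y)))) \<le> vectorspace.dim class_ring (span_vs (set (cols X)))"
    using vectorspace.subspace_dim[OF subspace_is_vs[OF s1] nested_subspaces[OF s1 s2 sub]]
      fin_dim_span_cols X XY by auto
  then show ?thesis by (simp add: rank_def)
qed

text \<open>The columns of \<open>B\<close> are a maximal independent set of columns of
  \<open>A\<close>; column \<open>j\<close> of \<open>C\<close> holds the coordinates of column
  \<open>j\<close> of \<open>A\<close> in it.\<close>

lemma (in vec_space) rank_factorization:
  assumes A: "A \<in> carrier_mat n q"
  obtains B C where "B \<in> carrier_mat n (rank A)" "C \<in> carrier_mat (rank A) q" "A = B * C"
proof -
  have cA: "set (cols A) \<subseteq> carrier_vec n" using cols_dim A by blast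
  obtain S where S: "maximal S (\<lambda>T. T \<subseteq> set (cols A) \<and> lin_indpt T)"
    using maximal_exists_superset[of "set (cols A)" "\<lambda>T. T \<subseteq> set (cols A) \<and> lin_indpt T" "{}"]
    by (metis (no_types, lifting) List.finite_set empty_subsetI lin_dep_crit finite_lin_indpt2 finite.emptyI empty_iff)
  have SA: "S \<subseteq> set (cols A)" and li: "lin_indpt S" using S by (auto simp: maximal_def)
  have Sc: "S \<subseteq> carrier_vec n" using SA cA by auto
  have fS: "finite S" using SA finite_subset by blast
  have r: "rank A = card S" using rank_card_indpt[OF A S] .
  obtain ss where ss: "set ss = S" "distinct ss" using fS finite_distinct_list by blast
  have len: "length ss = card S" using ss distinct_card by fastforce
  define B where "B = mat_of_cols n ss"
  have B: "B \<in> carrier_mat n (card S)" unfolding B_def len[symmetric] by (rule mat_of_cols_carrier)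
  have cB: "cols B = ss" using Sc ss by (simp add: B_def)
  have "\<exists>c \<in> carrier_vec (card S). col A j = B *\<^sub>v c" if j: "j < q" for j
  proof -
    have v: "col A j \<in> set (cols A)" using j A by (auto simp: cols_def)
    have "col A j \<in> span S"
    proof (rule ccontr)
      \<comment> \<open>A column outside the span could be added to \<open>S\<close>, against
        maximality.\<close>
      assume ns: "col A j \<notin> span S"
      have vc: "col A j \<in> carrier_vec n" using v cA by auto
      have nS: "col A j \<notin> S" using ns Sc span_mem by blast
      have "lin_indpt (S \<union> {col A j})"
        using lin_dep_iff_in_span[OF Sc li vc nS] ns by blast
      then have "S \<union> {col A j} = S"
        using S v SA unfolding maximal_def by blast
      with nS show False by blast
    qed
    then obtain a where "lincomb a S = col A j"
      using finite_in_span[OF fS] Sc by auto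
    then have "B *\<^sub>v vec (card S) (\<lambda>i. a (col B i)) = col A j"
      using mat_mult_eq_lincomb[OF B, of a] cB ss by simp
    then show ?thesis by (metis vec_carrier)
  qed
  then obtain c where c: "\<And>j. j < q \<Longrightarrow> c j \<in> carrier_vec (card S) \<and> col A j = B *\<^sub>v c j" by metis
  define C where "C = mat (card S) q (\<lambda>(i,j). c j $ i)"
  have C: "C \<in> carrier_mat (card S) q" by (simp add: C_def)
  have "A = B * C"
  proof (rule eq_matI)
    fix i j assume "i < dim_row (B * C)" "j < dim_col (B * C)"
    then have ij: "i < n" "j < q" using B C by auto
    have cc: "col C j = c j" using c[OF ij(2)] ij by (auto simp: C_def)
    have "A $$ (i,j) = col A j $ i" using A ij by simp
    also have "\<dots> = (B * C) $$ (i,j)" using c[OF ij(2)] ij B C cc by simp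
    finally show "A $$ (i,j) = (B * C) $$ (i,j)" .
  qed (use A B C in auto)
  with B C r that show thesis by simp
qed

lemma mat_rank_mult_le_left:
  fixes X Y :: "'a::field mat"
  assumes "X \<in> carrier_mat p r" "Y \<in> carrier_mat r q"
  shows "mat_rank (X * Y) \<le> mat_rank X"
  using vec_space.rank_mult_le_left[OF assms] assms by (simp add: mat_rank_def)

lemma mat_rank_factorization:
  fixes A :: "'a::field mat"
  assumes "A \<in> carrier_mat p q"
  obtains B C where "B \<in> carrier_mat p (mat_rank A)" "C \<in> carrier_mat (mat_rank A) q" "A = B * C"
  using vec_space.rank_factorization[OF assms] assms by (metis carrier_matD(1) mat_rank_def)

text \<open>Factoring \<open>Y = B * C\<close> through dimension \<open>mat_rank Y\<close> reduces
  this to the bound for the left factor: \<open>X * B\<close> has only \<open>mat_rank Y\<close>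
  columns.\<close>

lemma mat_rank_mult_le_right:
  fixes X Y :: "'a::field mat"
  assumes X: "X \<in> carrier_mat p r" and Y: "Y \<in> carrier_mat r q"
  shows "mat_rank (X * Y) \<le> mat_rank Y"
proof -
  obtain B C where B: "B \<in> carrier_mat r (mat_rank Y)" and C: "C \<in> carrier_mat (mat_rank Y) q"
    and "Y = B * C" using mat_rank_factorization[OF Y] .
  then have "X * Y = (X * B) * C" using assoc_mult_mat[OF X B C] by simp
  then have "mat_rank (X * Y) \<le> mat_rank (X * B)"
    using mat_rank_mult_le_left[of "X * B" p "mat_rank Y" C q] X B C by simp
  also have "\<dots> \<le> mat_rank Y" using mat_rank_le_dim_col[of "X * B"] X B by simp
  finally show ?thesis .
qed

section \<open>Invariance of the rank under invertible factors\<close>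

lemma det_nonzero_inverse:
  fixes A :: "'a::field mat"
  assumes "A \<in> carrier_mat n n" "det A \<noteq> 0"
  obtains B where "B \<in> carrier_mat n n" "A * B = 1\<^sub>m n" "B * A = 1\<^sub>m n"
  using det_non_zero_imp_unit[OF assms, unfolded Units_def, of "()"]
  by (auto simp: ring_mat_def)

lemma mat_rank_mult_det_nonzero_left:
  fixes X Y :: "'a::field mat"
  assumes X: "X \<in> carrier_mat p p" "det X \<noteq> 0" and Y: "Y \<in> carrier_mat p q"
  shows "mat_rank (X * Y) = mat_rank Y"
proof (rule antisym)
  obtain Z where Z: "Z \<in> carrier_mat p p" "Z * X = 1\<^sub>m p" using det_nonzero_inverse[OF X] .
  have "Z * (X * Y) = Y"
    unfolding assoc_mult_mat[OF Z(1) X(1) Y, symmetric] Z(2) by (rule left_mult_one_mat[OF Y])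
  then show "mat_rank Y \<le> mat_rank (X * Y)"
    using mat_rank_mult_le_right[OF Z(1) mult_carrier_mat[OF X(1) Y]] by metis
qed (rule mat_rank_mult_le_right[OF X(1) Y])

lemma mat_rank_mult_det_nonzero_right:
  fixes X Y :: "'a::field mat"
  assumes X: "X \<in> carrier_mat p q" and Y: "Y \<in> carrier_mat q q" "det Y \<noteq> 0"
  shows "mat_rank (X * Y) = mat_rank X"
proof (rule antisym)
  obtain Z where Z: "Z \<in> carrier_mat q q" "Y * Z = 1\<^sub>m q" using det_nonzero_inverse[OF Y] .
  have "X * Y * Z = X"
    unfolding assoc_mult_mat[OF X Y(1) Z(1)] Z(2) by (rule right_mult_one_mat[OF X])
  then show "mat_rank X \<le> mat_rank (X * Y)"
    using mat_rank_mult_le_left[OF mult_carrier_mat[OF X Y(1)] Z(1)] by metis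
qed (rule mat_rank_mult_le_left[OF X Y(1)])

section \<open>Ranks of products and of leading blocks\<close>

text \<open>An enumeration of \<open>P\<close> splits its matrix through dimension
  \<open>card P\<close>, which bounds the rank from above. Multiplying by the transposes of the two
  factors yields the identity of that size, which bounds it from below.\<close>

lemma mat_rank_relation_mat:
  assumes P: "partial_bij P" "P \<subseteq> {..<p} \<times> {..<q}"
  shows "mat_rank (relation_mat p q P :: 'a::field mat) = card P"
proof -
  define c where "c = card P"
  have "finite P" using P(2) finite_subset by blast
  then obtain e where e: "bij_betw e {..<c} P"
    using ex_bij_betw_nat_finite[of P] by (auto simp: c_def atLeast0LessThan)
  define R where "R = (\<lambda>t. (fst (e t), t)) ` {..<c}"
  define S where "S = (\<lambda>t. (t, snd (e t))) ` {..<c}"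
  have ein: "e t \<in> P" if "t < c" for t using e that by (auto dest: bij_betwE)
  have inj: "t = t'" if "t < c" "t' < c" "e t = e t'" for t t'
    using e that by (auto simp: bij_betw_def inj_on_def)
  have fst_inj: "t = t'" if "t < c" "t' < c" "fst (e t) = fst (e t')" for t t'
    using ein[OF that(1)] ein[OF that(2)] that P(1) inj
    by (metis partial_bij_def prod.collapse single_valuedD)
  have snd_inj: "t = t'" if "t < c" "t' < c" "snd (e t) = snd (e t')" for t t'
    using ein[OF that(1)] ein[OF that(2)] that P(1) inj
    by (metis converseI partial_bij_def prod.collapse single_valuedD)
  have svR: "single_valued R" unfolding R_def by (auto intro!: single_valuedI fst_inj)
  have svR': "single_valued (R\<inverse>)" unfolding R_def by (auto intro!: single_valuedI)
  have svS: "single_valued S" unfolding S_def by (auto intro!: single_valuedI)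
  have RS: "R O S = P"
  proof -
    have "R O S = (\<lambda>t. (fst (e t), snd (e t))) ` {..<c}"
      unfolding R_def S_def by (auto simp: image_iff relcomp_unfold) (metis fst_conv snd_conv)
    then show ?thesis using e by (simp add: bij_betw_def)
  qed
  have RR: "R\<inverse> O R = Id_on {..<c}" unfolding R_def by (auto dest: fst_inj)
  have SS: "S O S\<inverse> = Id_on {..<c}" unfolding S_def by (auto dest: snd_inj)
  have ranR: "Range R \<subseteq> {..<c}" unfolding R_def by auto
  have ranR': "Range (R\<inverse>) \<subseteq> {..<p}" using P(2) ein unfolding R_def by fastforce
  have ranS: "Range S \<subseteq> {..<q}" using P(2) ein unfolding S_def by fastforce
  have ranRP: "Range (R\<inverse> O P) \<subseteq> {..<q}" using P(2) by auto
  have RP: "R\<inverse> O P = S" unfolding RS[symmetric] O_assoc[symmetric] RR S_def by auto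
  let ?M = "relation_mat p q P :: 'a mat"
  have "?M = relation_mat p c R * relation_mat c q S"
    using relation_mat_mult[OF svR ranR, of p q S, where 'a='a] RS by simp
  then have "mat_rank ?M \<le> mat_rank (relation_mat p c R :: 'a mat)"
    using mat_rank_mult_le_left[of "relation_mat p c R :: 'a mat" p c "relation_mat c q S" q] by simp
  also have "\<dots> \<le> c" using mat_rank_le_dim_col[of "relation_mat p c R :: 'a mat"] by simp
  finally have le: "mat_rank ?M \<le> c" .
  have "relation_mat c p (R\<inverse>) * ?M = relation_mat c q S"
    using relation_mat_mult[OF svR' ranR', of c q P, where 'a='a] RP by simp
  moreover have "relation_mat c q S * relation_mat q c (S\<inverse>) = (1\<^sub>m c :: 'a mat)"
    using relation_mat_mult[OF svS ranS, of c c "S\<inverse>", where 'a='a] by (simp add: SS relation_mat_Id)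
  ultimately have "c \<le> mat_rank (relation_mat c p (R\<inverse>) * ?M)"
    using mat_rank_mult_le_left[of "relation_mat c q S :: 'a mat" c q "relation_mat q c (S\<inverse>)" c]
    by (simp add: mat_rank_one)
  also have "\<dots> \<le> mat_rank ?M" by (rule mat_rank_mult_le_right[of _ c p _ q]) auto
  finally show ?thesis using le c_def by simp
qed

lemma mat_rank_Id_on:
  assumes "X \<subseteq> {..<n}"
  shows "mat_rank (relation_mat n n (Id_on X) :: 'a::field mat) = card X"
proof -
  have "card (Id_on X) = card X"
    unfolding Id_on_def by (subst card_UN_disjoint) (use assms finite_subset in auto)
  moreover have "partial_bij (Id_on X)"
    by (auto simp: partial_bij_def single_valued_def)
  ultimately show ?thesis
    using mat_rank_relation_mat[of "Id_on X" n n, where 'a='a] assms by auto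
qed

text \<open>Up to invertible factors \<open>X\<close> is the 0-1 matrix \<open>?M\<close> of
  \<open>P\<close>. Split the identity as \<open>?D + ?E\<close>, the projections to the coordinates
  in \<open>Range P\<close> and to the rest: \<open>?D = ?N * ?M\<close> factors through
  \<open>?M\<close>, so its part of \<open>U * Y\<close> has rank at most that of
  \<open>X * Y\<close>, and \<open>?E\<close> has rank \<open>s - card P\<close>.\<close>

lemma sylvester_rank_inequality:
  fixes X Y :: "'a::field mat"
  assumes X: "X \<in> carrier_mat p s" and Y: "Y \<in> carrier_mat s q"
  shows "mat_rank X + mat_rank Y \<le> mat_rank (X * Y) + s"
proof -
  obtain L P U where L: "invertible_lower p L" and U: "invertible_upper s U" and P: "partial_bij P"
    "P \<subseteq> {..<p} \<times> {..<s}" and XP: "X = L * relation_mat p s P * U"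
    using lower_relation_upper_factorization[OF X] .
  note c = invertible_lower_carrier[OF L] invertible_upper_carrier[OF U]
  let ?M = "relation_mat p s P :: 'a mat"
  let ?N = "relation_mat s p (P\<inverse>) :: 'a mat"
  let ?D = "relation_mat s s (Id_on (Range P)) :: 'a mat"
  let ?E = "relation_mat s s (Id_on ({..<s} - Range P)) :: 'a mat"
  have ran: "Range P \<subseteq> {..<s}" "Range (P\<inverse>) \<subseteq> {..<p}" using P(2) by auto
  have card: "card (Range P) = card P"
  proof -
    have "inj_on snd P" using P(1) unfolding partial_bij_def inj_on_def single_valued_def by force
    then show ?thesis by (simp add: Range_snd card_image)
  qed
  have rX: "mat_rank X = card P"
    using mat_rank_mult_det_nonzero_right[of "L * ?M" p s U] mat_rank_mult_det_nonzero_left[of L p ?M s]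
      det_invertible_lower[OF L] det_invertible_upper[OF U] mat_rank_relation_mat[OF P, where 'a='a] c
    by (simp add: XP)
  have UY: "U * Y \<in> carrier_mat s q" using c Y by simp
  have rY: "mat_rank (U * Y) = mat_rank Y"
    using mat_rank_mult_det_nonzero_left[OF c(2) det_invertible_upper[OF U] Y] .
  have "X * Y = L * (?M * (U * Y))"
  proof -
    have LM: "L * ?M \<in> carrier_mat p s" using c by simp
    show ?thesis
      unfolding XP assoc_mult_mat[OF LM c(2) Y] assoc_mult_mat[OF c(1) relation_mat_carrier UY] ..
  qed
  then have rXY: "mat_rank (X * Y) = mat_rank (?M * (U * Y))"
    using mat_rank_mult_det_nonzero_left[OF c(1) det_invertible_lower[OF L]
        mult_carrier_mat[OF relation_mat_carrier UY]] by simp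
  have NM: "?N * ?M = ?D"
  proof -
    have "P\<inverse> O P = Id_on (Range P)" using P(1) by (auto simp: partial_bij_def dest: single_valuedD)
    moreover have "single_valued (P\<inverse>)" using P(1) by (simp add: partial_bij_def)
    ultimately show ?thesis using relation_mat_mult[OF _ ran(2), of s s P, where 'a='a] by simp
  qed
  have "?D + ?E = 1\<^sub>m s" by (rule eq_matI) auto
  then have split: "U * Y = ?D * (U * Y) + ?E * (U * Y)"
    using add_mult_distrib_mat[of ?D s s ?E "U * Y" q] left_mult_one_mat[OF UY] UY by simp
  have "mat_rank (U * Y) = mat_rank (?D * (U * Y) + ?E * (U * Y))"
    by (rule arg_cong[OF split])
  also have "\<dots> \<le> mat_rank (?D * (U * Y)) + mat_rank (?E * (U * Y))"
    by (rule mat_rank_add_le; rule mult_carrier_mat[OF relation_mat_carrier UY])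
  also have "mat_rank (?D * (U * Y)) \<le> mat_rank (?M * (U * Y))"
    using mat_rank_mult_le_right[of ?N s p "?M * (U * Y)" q,
        OF relation_mat_carrier mult_carrier_mat[OF relation_mat_carrier UY]]
      assoc_mult_mat[of ?N s p ?M s "U * Y" q, OF relation_mat_carrier relation_mat_carrier UY]
    by (simp add: NM)
  also have "mat_rank (?E * (U * Y)) \<le> mat_rank ?E"
    by (rule mat_rank_mult_le_left[OF relation_mat_carrier UY])
  also have "mat_rank ?E = s - card P"
    using mat_rank_Id_on[of "{..<s} - Range P" s, where 'a='a] ran(1) card
    by (simp add: card_Diff_subset finite_subset)
  finally have "mat_rank Y \<le> mat_rank (X * Y) + (s - card P)"
    using rXY rY by simp
  moreover have "card P \<le> s" using card_mono[OF _ ran(1)] card by simp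
  ultimately show ?thesis using rX by simp
qed

section \<open>Leading blocks of triangular and banded products\<close>

lemma invertible_lower_leading:
  assumes "invertible_lower p L" "a \<le> p"
  shows "invertible_lower a (submatrix L {0..<a} {0..<a})"
  using assms submatrix_leading[OF invertible_lower_carrier[OF assms(1)] assms(2,2)]
  by (auto simp: invertible_lower_def almost_lower_triangular_def)

lemma invertible_upper_leading:
  assumes "invertible_upper p U" "a \<le> p"
  shows "invertible_upper a (submatrix U {0..<a} {0..<a})"
  using assms submatrix_leading[OF invertible_upper_carrier[OF assms(1)] assms(2,2)]
  by (auto simp: invertible_upper_def almost_upper_triangular_def)

text \<open>Leading blocks multiply when the left factor is lower or the right factor is upper
  triangular, so the outer blocks are invertible and the rank counts the pairs of \<open>P\<close>
  in the rectangle.\<close>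

lemma mat_rank_leading_submatrix:
  fixes L U :: "'a::field mat"
  assumes L: "invertible_lower p L" and U: "invertible_upper q U"
    and P: "partial_bij P" "P \<subseteq> {..<p} \<times> {..<q}" and le: "a \<le> p" "b \<le> q"
  shows "mat_rank (submatrix (L * relation_mat p q P * U) {0..<a} {0..<b})
    = card (P \<inter> {..<a} \<times> {..<b})"
proof -
  let ?M = "relation_mat p q P :: 'a mat"
  note c = invertible_lower_carrier[OF L] invertible_upper_carrier[OF U]
  let ?L = "submatrix L {0..<a} {0..<a}" and ?U = "submatrix U {0..<b} {0..<b}"
  let ?N = "submatrix ?M {0..<a} {0..<b}"
  have L': "invertible_lower a ?L" and U': "invertible_upper b ?U"
    using invertible_lower_leading[OF L le(1)] invertible_upper_leading[OF U le(2)] .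
  note c' = invertible_lower_carrier[OF L'] invertible_upper_carrier[OF U']
  have N: "?N = relation_mat a b (P \<inter> {..<a} \<times> {..<b})"
    unfolding submatrix_leading[OF relation_mat_carrier le] using le by (intro eq_matI) auto
  have "submatrix (L * ?M * U) {0..<a} {0..<b} = submatrix (L * ?M) {0..<a} {0..<b} * ?U"
    using c le by (intro submatrix_leading_mult[of _ p q _ q]) (simp_all add: invertible_upper_zero[OF U])
  also have "submatrix (L * ?M) {0..<a} {0..<b} = ?L * ?N"
    using c le by (intro submatrix_leading_mult[of _ p p _ q]) (simp_all add: invertible_lower_zero[OF L])
  finally have "mat_rank (submatrix (L * ?M * U) {0..<a} {0..<b}) = mat_rank (?L * ?N * ?U)" by simp
  also have "\<dots> = mat_rank (?L * ?N)"
    using c' det_invertible_upper[OF U'] by (intro mat_rank_mult_det_nonzero_right[of _ a b]) (auto simp: N)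
  also have "\<dots> = mat_rank ?N"
    using c' det_invertible_lower[OF L'] by (intro mat_rank_mult_det_nonzero_left[of _ a _ b]) (auto simp: N)
  also have "\<dots> = card (P \<inter> {..<a} \<times> {..<b})"
    unfolding N by (intro mat_rank_relation_mat partial_bij_subset[OF P(1)]) auto
  finally show ?thesis .
qed

text \<open>The first \<open>k\<close> rows of \<open>K\<close> and the first \<open>k\<close>
  columns of \<open>W\<close> vanish at inner indices from \<open>k + m\<close> on. So the wide
  block factors through \<open>?X\<close>, the tall block through \<open>?Y\<close>, and the square
  block is \<open>?X * ?Y\<close>, to which Sylvester's inequality applies.\<close>

lemma rank_condition_if_factorization:
  fixes K W :: "'a::field mat"
  assumes K: "K \<in> carrier_mat n n" "almost_lower_triangular m K"
    and W: "W \<in> carrier_mat n n" "almost_upper_triangular m W" and k: "k \<le> n"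
  shows "mat_rank (submatrix (K * W) {0..<k} {0..<n}) + mat_rank (submatrix (K * W) {0..<n} {0..<k})
    \<le> mat_rank (submatrix (K * W) {0..<k} {0..<k}) + k + m"
proof -
  \<comment> \<open>The inner dimension is capped at \<open>n\<close>, since \<open>k + m\<close>
    may exceed it.\<close>
  define s where "s = min (k + m) n"
  have s: "s \<le> n" "s \<le> k + m" by (auto simp: s_def)
  have beyond: "k + m \<le> l" if "s \<le> l" "l < n" for l using that by (simp add: s_def)
  have zK: "K $$ (i, l) = 0" if "i < k" "s \<le> l" "l < n" for i l
    using that K k beyond[of l] by (simp add: almost_lower_triangular_def)
  have zW: "W $$ (l, j) = 0" if "j < k" "s \<le> l" "l < n" for j l
    using that W k beyond[of l] by (simp add: almost_upper_triangular_def)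
  let ?X = "submatrix K {0..<k} {0..<s}" and ?Y = "submatrix W {0..<s} {0..<k}"
  have c: "?X \<in> carrier_mat k s" "?Y \<in> carrier_mat s k"
    "submatrix W {0..<s} {0..<n} \<in> carrier_mat s n" "submatrix K {0..<n} {0..<s} \<in> carrier_mat n s"
    using K W k s by (simp_all add: submatrix_leading[of _ n n])
  have "submatrix (K * W) {0..<k} {0..<n} = ?X * submatrix W {0..<s} {0..<n}"
    using zK by (intro submatrix_leading_mult[OF K(1) W(1) k _ s(1)]) auto
  then have "mat_rank (submatrix (K * W) {0..<k} {0..<n}) \<le> mat_rank ?X"
    using mat_rank_mult_le_left[OF c(1,3)] by simp
  moreover have "submatrix (K * W) {0..<n} {0..<k} = submatrix K {0..<n} {0..<s} * ?Y"
    using zW by (intro submatrix_leading_mult[OF K(1) W(1) _ k s(1)]) auto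
  then have "mat_rank (submatrix (K * W) {0..<n} {0..<k}) \<le> mat_rank ?Y"
    using mat_rank_mult_le_right[OF c(4,2)] by simp
  moreover have "submatrix (K * W) {0..<k} {0..<k} = ?X * ?Y"
    using zW by (intro submatrix_leading_mult[OF K(1) W(1) k k s(1)]) auto
  then have "mat_rank ?X + mat_rank ?Y \<le> mat_rank (submatrix (K * W) {0..<k} {0..<k}) + s"
    using sylvester_rank_inequality[OF c(1,2)] by simp
  ultimately show ?thesis using s(2) by linarith
qed

theorem theorem3:
  fixes A :: "'a::field mat" and n m :: nat
  assumes "n \<ge> 1"
    and "A \<in> carrier_mat n n"
  shows "(\<exists>K \<in> carrier_mat n n. \<exists>W \<in> carrier_mat n n.
            almost_lower_triangular m K \<and> almost_upper_triangular m W \<and> A = K * W)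
     \<longleftrightarrow>
         (\<forall>k \<in> {1..n}.
            mat_rank (submatrix A {0..<k} {0..<k}) + k + m
              \<ge> mat_rank (submatrix A {0..<k} {0..<n}) + mat_rank (submatrix A {0..<n} {0..<k}))"
    (is "?fact \<longleftrightarrow> ?rank")
proof
  assume ?fact
  then obtain K W where K: "K \<in> carrier_mat n n" "almost_lower_triangular m K"
    and W: "W \<in> carrier_mat n n" "almost_upper_triangular m W" and A: "A = K * W" by blast
  show ?rank
  proof
    fix k assume "k \<in> {1..n}"
    then show "mat_rank (submatrix A {0..<k} {0..<n}) + mat_rank (submatrix A {0..<n} {0..<k})
        \<le> mat_rank (submatrix A {0..<k} {0..<k}) + k + m"
      unfolding A by (intro rank_condition_if_factorization[OF K W]) simp
  qed
next
  assume rank: ?rank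
  obtain L P U where L: "invertible_lower n L" and U: "invertible_upper n U"
    and P: "partial_bij P" "P \<subseteq> {..<n} \<times> {..<n}" and A: "A = L * relation_mat n n P * U"
    using lower_relation_upper_factorization[OF assms(2)] .
  have c: "L \<in> carrier_mat n n" "U \<in> carrier_mat n n"
    and tri: "almost_lower_triangular 0 L" "almost_upper_triangular 0 U"
    using L U by (auto simp: invertible_lower_def invertible_upper_def)
  \<comment> \<open>The ranks of the leading blocks of \<open>A\<close> are counts of pairs in
    \<open>P\<close>, so the rank condition is the counting hypothesis.\<close>
  have "card (P \<inter> {..<k} \<times> {..<n}) + card (P \<inter> {..<n} \<times> {..<k})
      \<le> card (P \<inter> {..<k} \<times> {..<k}) + k + m" if "1 \<le> k" "k \<le> n" for k
    using rank that by (auto simp: A mat_rank_leading_submatrix[OF L U P])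
  then obtain K W :: "'a mat" where K: "K \<in> carrier_mat n n" "almost_lower_triangular m K"
    and W: "W \<in> carrier_mat n n" "almost_upper_triangular m W" and KW: "relation_mat n n P = K * W"
    using relation_mat_factorization[OF P, where 'a='a] by metis
  \<comment> \<open>The triangular factors are absorbed into the banded ones; having no extra
    diagonals, they keep the width \<open>m\<close>.\<close>
  have "A = (L * K) * (W * U)"
    unfolding A KW assoc_mult_mat[OF c(1) K(1) W(1), symmetric]
    by (rule assoc_mult_mat[OF mult_carrier_mat[OF c(1) K(1)] W(1) c(2)])
  then show ?fact
    using almost_lower_triangular_mult[OF c(1) tri(1) K] almost_upper_triangular_mult[OF W c(2) tri(2)]
      mult_carrier_mat[OF c(1) K(1)] mult_carrier_mat[OF W(1) c(2)]
    by auto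
qed

end
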